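(* Let $n\ge2$, $k>0$, and let $\lambda_1,\dots,\lambda_n>0$ be pairwise distinct. Let $Z\sim MHP(k,\lambda_1,\dots,\lambda_n)$, let $Y_i\sim\mathrm{Power}(k,\lambda_i)$, and put $PP_i=\prod_{j=1,\,j\ne i}^n\left(1-\frac{\lambda_i}{\lambda_j}\right)$. Then the cumulative distribution function of $Z$ is $$F_Z(t)=\sum_{i=1}^n\frac{1}{PP_i}F_{Y_i}(t)=\begin{cases}\displaystyle\sum_{i=1}^n\frac{(kt)^{\lambda_i}}{\prod_{j=1,\,j\neq i}^n\left(1-\frac{\lambda_i}{\lambda_j}\right)}, & 0<t<\frac1k,\\[3ex] \displaystyle\sum_{i=1}^n\frac{1}{\prod_{j=1,\,j\neq i}^n\left(1-\frac{\lambda_i}{\lambda_j}\right)}, & t>\frac1k.\end{cases}$$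
   Context: $\mathrm{Power}(k,\lambda)$ with domain parameter $k>0$ and shape parameter $\lambda>0$ has density $\lambda k^{\lambda}t^{\lambda-1}$ for $0<t<\frac1k$. The Mixed Hypoexponential Power distribution $MHP(k,\lambda_1,\dots,\lambda_n)$ is the distribution with density $f_Z(t)=\sum_{i=1}^n\frac{1}{PP_i}f_{Y_i}(t)$. $F_X$ denotes the cumulative distribution function of $X$. *)

theory Defs
  imports "HOL-Probability.Probability"
begin

definition power_density :: "real \<Rightarrow> real \<Rightarrow> real \<Rightarrow> real" where
  "power_density k l t =
     (if 0 < t \<and> t < 1 / k then l * k powr l * t powr (l - 1) else 0)"

definition PP :: "nat \<Rightarrow> (nat \<Rightarrow> real) \<Rightarrow> nat \<Rightarrow> real" where
  "PP n l i = (\<Prod>j\<in>{1..n} - {i}. 1 - l i / l j)"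

text \<open>
  Some of the weights \<open>1 / PP n l i\<close>
  are negative, but for \<open>k > 0\<close> and pairwise distinct positive \<open>l 1, \<dots>, l n\<close> the sum is a
  nonnegative function: it is the density of \<open>exp (- X) / k\<close> where \<open>X\<close> is a sum of independent
  exponential variables with rates \<open>l 1, \<dots>, l n\<close>. Hence applying \<open>ennreal\<close> to it, as
  \<open>distributed\<close> requires, does not cut anything off.
\<close>

definition MHP_density :: "nat \<Rightarrow> real \<Rightarrow> (nat \<Rightarrow> real) \<Rightarrow> real \<Rightarrow> real" where
  "MHP_density n k l t = (\<Sum>i=1..n. 1 / PP n l i * power_density k (l i) t)"

end

theory Submission
  imports Defs "HOL-Computational_Algebra.Polynomial"
begin

text \<open>
  The only delicate point is that the weights \<open>1 / PP n l i\<close> change sign, while \<open>distributed\<close> only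
  sees the positive part of the mixture density \<open>f\<close>. Lagrange interpolation of the constant \<open>1\<close> at
  the nodes \<open>l 1, \<dots>, l n\<close>, evaluated at \<open>0\<close>, shows that the weights sum to \<open>1\<close>, so \<open>f\<close> has
  integral \<open>1\<close>. Its positive part, being the density of \<open>Z\<close>, has integral \<open>1\<close> too. Hence the
  negative part vanishes almost everywhere, and the distribution function is linear in the density.
\<close>

lemma sum_inverse_prod_one_minus_quotient:
  fixes l :: "'i \<Rightarrow> 'a::field"
  assumes fin: "finite A" and ne: "A \<noteq> {}" and inj: "inj_on l A"
    and nz: "\<And>i. i \<in> A \<Longrightarrow> l i \<noteq> 0"
  shows "(\<Sum>i\<in>A. 1 / (\<Prod>j\<in>A - {i}. 1 - l i / l j)) = 1"
proof -
  \<comment> \<open>\<open>L i\<close> is the Lagrange basis polynomial of the node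
    \<open>l i\<close>, and \<open>p\<close> is the error of interpolating the constant 1. It
    vanishes at all \<open>card A\<close> nodes but has smaller degree, so it is zero.\<close>
  define L where "L i = (\<Prod>j\<in>A - {i}. smult (1 / (l i - l j)) [:- l j, 1:])" for i
  define p where "p = (\<Sum>i\<in>A. L i) - 1"
  have neq: "l i \<noteq> l j" if "i \<in> A" "j \<in> A - {i}" for i j
    using inj that by (auto dest: inj_onD)
  have L_node: "poly (L i) (l m) = (if m = i then 1 else 0)" if "i \<in> A" "m \<in> A" for i m
  proof (cases "m = i")
    case True
    have "poly (L i) (l i) = (\<Prod>j\<in>A - {i}. 1)"
      unfolding L_def poly_prod using neq[OF that(1)]
      by (intro prod.cong) (simp_all flip: diff_divide_distrib)
    with True show ?thesis by simp
  next
    case False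
    with that fin have "poly (L i) (l m) = 0"
      unfolding L_def poly_prod by (intro prod_zero) auto
    with False show ?thesis by simp
  qed
  have roots: "l ` A \<subseteq> {x. poly p x = 0}"
  proof safe
    fix m assume "m \<in> A"
    with fin have "(\<Sum>i\<in>A. poly (L i) (l m)) = 1"
      by (simp add: L_node)
    then show "poly p (l m) = 0" by (simp add: p_def poly_sum)
  qed
  have "degree (L i) \<le> card A - 1" if "i \<in> A" for i
  proof -
    have "degree (L i) \<le> (\<Sum>j\<in>A - {i}. degree (smult (1 / (l i - l j)) [:- l j, 1:]))"
      unfolding L_def using fin by (intro degree_prod_sum_le[unfolded o_def]) simp
    also have "\<dots> \<le> (\<Sum>j\<in>A - {i}. 1)"
      by (intro sum_mono) (auto intro: order.trans[OF degree_smult_le])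
    finally show ?thesis using fin that by simp
  qed
  then have "degree p \<le> card A - 1"
    unfolding p_def using fin by (intro degree_diff_le degree_sum_le) auto
  \<comment> \<open>Nonemptiness enters here: subtraction on naturals truncates, and for empty
    \<open>A\<close> the bound would not be strict.\<close>
  then have deg: "degree p < card A"
    using fin ne by (metis One_nat_def Suc_pred card_gt_0_iff le_imp_less_Suc)
  have "p = 0"
  proof (rule ccontr)
    assume "p \<noteq> 0"
    then have "card (l ` A) \<le> degree p"
      using card_mono[OF poly_roots_finite roots] card_poly_roots_bound by force
    with deg inj show False by (simp add: card_image)
  qed
  then have "(\<Sum>i\<in>A. poly (L i) 0) = 1"
    by (simp add: p_def flip: poly_sum)
  \<comment> \<open>At 0 the factor of \<open>L i\<close> for \<open>j\<close> is
    \<open>- l j / (l i - l j)\<close>; dividing both parts by \<open>- l j\<close> turns it into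
    the reciprocal of a factor of the weight's denominator.\<close>
  moreover have "poly (L i) 0 = 1 / (\<Prod>j\<in>A - {i}. 1 - l i / l j)" if "i \<in> A" for i
  proof -
    have "poly (L i) 0 = (\<Prod>j\<in>A - {i}. 1 / (1 - l i / l j))"
      unfolding L_def poly_prod
    proof (intro prod.cong refl)
      fix j assume j: "j \<in> A - {i}"
      with nz neq[OF that j] show "poly (smult (1 / (l i - l j)) [:- l j, 1:]) 0 = 1 / (1 - l i / l j)"
        by (auto simp: divide_simps algebra_simps)
    qed
    then show ?thesis by (simp add: prod_dividef)
  qed
  ultimately show ?thesis by simp
qed

text \<open>Both parts are the change of variables formula for the expectation of a function of
  \<open>X\<close>, applied to the constant 1 and to the indicator of \<open>{..t}\<close>. The
  first gives the normalization of \<open>f\<close> without computing an integral.\<close>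

lemma
  fixes X :: "'a \<Rightarrow> real" and f :: "real \<Rightarrow> real"
  assumes "prob_space M" and X: "distributed M lborel X (\<lambda>t. ennreal (f t))"
    and nonneg: "\<And>t. 0 \<le> f t"
  shows distributed_has_bochner_integral_1: "has_bochner_integral lborel f 1"
    and distributed_cdf: "cdf (distr M borel X) t = (\<integral>x. f x * indicator {..t} x \<partial>lborel)"
proof -
  interpret prob_space M by fact
  have X_meas[measurable]: "X \<in> borel_measurable M"
    using distributed_measurable[OF X] by simp
  show "has_bochner_integral lborel f 1"
    using distributed_integrable[OF X, of "\<lambda>_. 1"] distributed_integral[OF X, of "\<lambda>_. 1"] nonneg
    by (simp add: has_bochner_integral_iff prob_space)
  have "cdf (distr M borel X) t = measure M (X -` {..t} \<inter> space M)"
    by (simp add: cdf_def measure_distr)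
  also have "\<dots> = (\<integral>x. indicator (X -` {..t} \<inter> space M) x \<partial>M)"
    by simp
  also have "\<dots> = (\<integral>x. indicator {..t} (X x) \<partial>M)"
    by (intro Bochner_Integration.integral_cong) (auto split: split_indicator)
  also have "\<dots> = (\<integral>x. f x * indicator {..t} x \<partial>lborel)"
    using distributed_integral[OF X, of "indicator {..t}"] nonneg by simp
  finally show "cdf (distr M borel X) t = (\<integral>x. f x * indicator {..t} x \<partial>lborel)" .
qed

text \<open>Trades pointwise nonnegativity for total integral 1, which is far easier to check for a
  mixture with signed weights.\<close>

lemma distributed_cdf_of_integral_1:
  fixes X :: "'a \<Rightarrow> real" and f :: "real \<Rightarrow> real"
  assumes "prob_space M" and X: "distributed M lborel X (\<lambda>t. ennreal (f t))"
    and f: "has_bochner_integral lborel f 1"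
  shows "cdf (distr M borel X) t = (\<integral>x. f x * indicator {..t} x \<partial>lborel)"
proof -
  \<comment> \<open>\<open>ennreal\<close> sends negative reals to 0, so \<open>f\<close> and its
    positive part yield the same density.\<close>
  have X': "distributed M lborel X (\<lambda>t. ennreal (max 0 (f t)))"
    using X by (simp add: ennreal_max_0)
  have pos: "has_bochner_integral lborel (\<lambda>t. max 0 (f t)) 1"
    by (rule distributed_has_bochner_integral_1[OF assms(1) X']) simp
  have "has_bochner_integral lborel (\<lambda>t. max 0 (f t) - f t) (1 - 1)"
    by (rule has_bochner_integral_diff[OF pos f])
  then have "AE t in lborel. max 0 (f t) - f t = 0"
    by (subst integral_nonneg_eq_0_iff_AE[symmetric]) (auto simp: has_bochner_integral_iff)
  then have "(\<integral>x. max 0 (f x) * indicator {..t} x \<partial>lborel) = (\<integral>x. f x * indicator {..t} x \<partial>lborel)"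
    using f pos
    by (intro integral_cong_AE) (auto simp: has_bochner_integral_iff intro!: borel_measurable_times)
  with distributed_cdf[OF assms(1) X'] show ?thesis by simp
qed

lemma power_density_nonneg: "0 < l \<Longrightarrow> 0 \<le> power_density k l t"
  by (simp add: power_density_def)

lemma
  assumes "prob_space M" and X: "distributed M lborel X (\<lambda>t. ennreal (power_density k l t))"
    and k: "0 < k" and l: "0 < l"
  shows power_cdf_inside: "\<lbrakk>0 < t; t < 1 / k\<rbrakk> \<Longrightarrow> cdf (distr M borel X) t = (k * t) powr l"
    and power_cdf_above: "t > 1 / k \<Longrightarrow> cdf (distr M borel X) t = 1"
proof -
  note cdf = distributed_cdf[OF assms(1) X power_density_nonneg[OF l]]
  have int: "has_bochner_integral lborel (power_density k l) 1"
    by (rule distributed_has_bochner_integral_1[OF assms(1) X power_density_nonneg[OF l]])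
  show "cdf (distr M borel X) t = 1" if "t > 1 / k"
  proof -
    \<comment> \<open>Beyond \<open>1 / k\<close> the indicator cuts off nothing of the support,
      leaving the total mass.\<close>
    have "(\<lambda>x. power_density k l x * indicator {..t} x) = power_density k l"
      using that by (auto simp: power_density_def split: split_indicator)
    with cdf int show ?thesis by (simp add: has_bochner_integral_iff)
  qed
  assume t: "0 < t" "t < 1 / k"
  define g where "g x = power_density k l x * indicator {..t} x" for x
  \<comment> \<open>For \<open>l < 1\<close> the integrand is unbounded near 0; the rule used covers
    every exponent above -1, hence every \<open>l > 0\<close>.\<close>
  have "((\<lambda>x. l * k powr l * x powr (l - 1)) has_integral (l * k powr l * (t powr l / l))) {0..t}"
    using has_integral_mult_right[OF has_integral_powr_from_0[of "l - 1" t], of "l * k powr l"] l t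
    by simp
  also have "l * k powr l * (t powr l / l) = (k * t) powr l"
    using l k t by (simp add: powr_mult)
  finally have "(g has_integral (k * t) powr l) {0..t}"
    by (rule has_integral_spike[of "{0}", rotated 2])
       (use t in \<open>auto simp: g_def power_density_def\<close>)
  then have "(g has_integral (k * t) powr l) UNIV"
    by (rule has_integral_on_superset) (auto simp: g_def power_density_def split: split_indicator)
  \<comment> \<open>The value above is a gauge integral; Lebesgue integrability identifies it with
    the integral in the cdf formula.\<close>
  moreover have "integrable lborel g"
    unfolding g_def using int by (auto simp: has_bochner_integral_iff intro: integrable_real_mult_indicator)
  ultimately have "integral\<^sup>L lborel g = (k * t) powr l"
    using has_integral_integral_lborel has_integral_unique by blast
  with cdf show "cdf (distr M borel X) t = (k * t) powr l"
    unfolding g_def by simp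
qed

theorem corollary5:
  fixes n :: nat and k :: real and l :: "nat \<Rightarrow> real"
    and M :: "'a measure" and Z :: "'a \<Rightarrow> real"
    and N :: "nat \<Rightarrow> 'b measure" and Y :: "nat \<Rightarrow> 'b \<Rightarrow> real"
  assumes "n \<ge> 2" and "k > 0"
    and "\<And>i. i \<in> {1..n} \<Longrightarrow> l i > 0"
    and "inj_on l {1..n}"
    and "prob_space M"
    and "distributed M lborel Z (\<lambda>t. ennreal (MHP_density n k l t))"
    and "\<And>i. i \<in> {1..n} \<Longrightarrow> prob_space (N i)"
    and "\<And>i. i \<in> {1..n} \<Longrightarrow>
           distributed (N i) lborel (Y i) (\<lambda>t. ennreal (power_density k (l i) t))"
  shows "(\<forall>t. cdf (distr M borel Z) t
            = (\<Sum>i=1..n. 1 / PP n l i * cdf (distr (N i) borel (Y i)) t))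
       \<and> (\<forall>t. 0 < t \<and> t < 1 / k \<longrightarrow>
            cdf (distr M borel Z) t
            = (\<Sum>i=1..n. (k * t) powr l i / (\<Prod>j\<in>{1..n} - {i}. 1 - l i / l j)))
       \<and> (\<forall>t. t > 1 / k \<longrightarrow>
            cdf (distr M borel Z) t
            = (\<Sum>i=1..n. 1 / (\<Prod>j\<in>{1..n} - {i}. 1 - l i / l j)))"
proof -
  note cdf_Y = distributed_cdf[OF assms(7) assms(8) power_density_nonneg[OF assms(3)]]
  have int_Y: "has_bochner_integral lborel (power_density k (l i)) 1" if "i \<in> {1..n}" for i
    using distributed_has_bochner_integral_1[OF assms(7) assms(8) power_density_nonneg[OF assms(3)]]
      that by blast
  have weights: "(\<Sum>i=1..n. 1 / PP n l i) = 1"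
    unfolding PP_def using assms(1,3,4)
    by (intro sum_inverse_prod_one_minus_quotient) force+
  \<comment> \<open>Each component has mass 1, so the mass of the mixture is the sum of its
    weights.\<close>
  have "has_bochner_integral lborel (MHP_density n k l) (\<Sum>i=1..n. 1 / PP n l i * 1)"
    unfolding MHP_density_def
    by (intro has_bochner_integral_sum has_bochner_integral_mult_right int_Y)
  with weights have int_Z: "has_bochner_integral lborel (MHP_density n k l) 1"
    by simp
  \<comment> \<open>Negative weights do no harm to linearity here, since every truncated component
    is integrable.\<close>
  have mix: "cdf (distr M borel Z) t = (\<Sum>i=1..n. 1 / PP n l i * cdf (distr (N i) borel (Y i)) t)" for t
  proof -
    have "cdf (distr M borel Z) t
        = (\<integral>x. (\<Sum>i=1..n. 1 / PP n l i * (power_density k (l i) x * indicator {..t} x)) \<partial>lborel)"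
      using distributed_cdf_of_integral_1[OF assms(5,6) int_Z]
      by (simp add: MHP_density_def sum_distrib_right mult.assoc)
    also have "\<dots> = (\<Sum>i=1..n. 1 / PP n l i * (\<integral>x. power_density k (l i) x * indicator {..t} x \<partial>lborel))"
      using int_Y by (subst Bochner_Integration.integral_sum)
        (auto simp: has_bochner_integral_iff
          intro!: integrable_mult_right integrable_real_mult_indicator)
    finally show ?thesis by (simp add: cdf_Y)
  qed
  moreover have "cdf (distr (N i) borel (Y i)) t = (k * t) powr l i"
    if "i \<in> {1..n}" "0 < t" "t < 1 / k" for i t
    using power_cdf_inside[OF assms(7,8,2,3)] that by blast
  moreover have "cdf (distr (N i) borel (Y i)) t = 1" if "i \<in> {1..n}" "t > 1 / k" for i t
    using power_cdf_above[OF assms(7,8,2,3)] that by blast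
  ultimately show ?thesis by (simp add: PP_def)
qed

end
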